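(* Let $\mathbb P$ be a collection of tri-tiles, let $\Lambda_{\mathbb P}$ be the associated trilinear form, and let $1\le s_1,s_2,s_3<\infty$. Assume that $$|\Lambda_{\mathbb P(I_0)}(f,g,h)|\lesssim\Big(\sup_{P\in\mathbb P(I_0)^+}\frac1{|I_P|}\int_{\mathbb R}|f|^{s_1}\tilde\chi_{I_P}^M\,dx\Big)^{\frac1{s_1}}\Big(\sup_{P\in\mathbb P(I_0)^+}\frac1{|I_P|}\int_{\mathbb R}|g|^{s_2}\tilde\chi_{I_P}^M\,dx\Big)^{\frac1{s_2}}\Big(\sup_{P\in\mathbb P(I_0)^+}\frac1{|I_P|}\int_{\mathbb R}|h|^{s_3}\tilde\chi_{I_P}^M\,dx\Big)^{\frac1{s_3}}|I_0|$$ holds for any dyadic interval $I_0$ and any locally integrable functions $f,g,h$. Then there exists a sparse family $\mathcal S$ of intervals, depending on $f,g,h$ and on $s_1,s_2,s_3$, such that $$|\Lambda_{\mathbb P}(f,g,h)|\lesssim\sum_{Q\in\mathcal S}\Big(\frac1{|Q|}\int_{\mathbb R}|f|^{s_1}\tilde\chi_Q^{M-1}dx\Big)^{\frac1{s_1}}\Big(\frac1{|Q|}\int_{\mathbb R}|g|^{s_2}\tilde\chi_Q^{M-1}dx\Big)^{\frac1{s_2}}\Big(\frac1{|Q|}\int_{\mathbb R}|h|^{s_3}\tilde\chi_Q^{M-1}dx\Big)^{\frac1{s_3}}|Q|.$$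
   Context: Tiles: a tile is a rectangle $I_P\times\omega_P$ of area one with $I_P$ a dyadic interval and $\omega_P$ an interval of a certain translate of the dyadic grid. A tri-tile is a triple $P=(P_1,P_2,P_3)$ of tiles sharing the same spatial interval $I_P$. A wave packet associated to a tile $I_P\times\omega_P$ is a smooth function $\phi$ with $\mathrm{supp}\,\hat\phi\subseteq\frac9{10}\omega_P$ and $|\phi^{(k)}(x)|\le C_{k,N}|I_P|^{-\frac12-k}\big(1+\frac{\mathrm{dist}(x,I_P)}{|I_P|}\big)^{-N}$ for sufficiently many derivatives $k$ and any $N>0$. Form: $\Lambda_{\mathbb P}(f,g,h)=\sum_{P\in\mathbb P}|I_P|^{-1/2}\langle f,\phi_P^1\rangle\langle g,\phi_P^2\rangle\langle h,\phi_P^3\rangle$ with $\phi_P^j$ wave packets associated to $P_j$. For a dyadic interval $I_0$, $\mathbb P(I_0)=\{P\in\mathbb P:I_P\subseteq I_0\}$, and $\mathbb P(I_0)^+$ is $\mathbb P(I_0)$ together with one tri-tile (not necessarily in $\mathbb P$) with spatial interval $I_0$. $\tilde\chi_I(x)=\big(1+\frac{\mathrm{dist}(x,I)}{|I|}\big)^{-100}$ and $M$ is a fixed large exponent. Sparse: a collection $\mathcal S$ of dyadic intervals is $\eta$-sparse ($0<\eta<1$) if there are pairwise disjoint measurable $E_Q\subseteq Q$, $Q\in\mathcal S$, with $|E_Q|\ge\eta|Q|$; "sparse" means $\eta$-sparse for a fixed $\eta$ not depending on the functions.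
   Formalization: The estimate is assumed, with one common constant, for every subcollection of the collection of tri-tiles, not only for the collection itself; assumed for one fixed collection only, the claim fails, since tri-tiles with zero wave packets can enlarge the suprema. *)

theory Defs
  imports "HOL-Analysis.Analysis"
begin

text \<open>Intervals, tiles and tri-tiles\<close>

definition dyadic_intervals :: "real set set" where
  "dyadic_intervals =
     {{2 powi k * of_int n ..< 2 powi k * (of_int n + 1)} | k n :: int. True}"

definition translated_dyadic :: "real \<Rightarrow> real set set" where
  "translated_dyadic \<theta> = (\<lambda>J. (\<lambda>x. x + \<theta>) ` J) ` dyadic_intervals"

abbreviation len :: "real set \<Rightarrow> real" where
  "len J \<equiv> measure lebesgue J"

definition dilate :: "real \<Rightarrow> real set \<Rightarrow> real set" where
  "dilate c J = (let m = (Inf J + Sup J) / 2 in (\<lambda>x. m + c * (x - m)) ` J)"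

text \<open>A tile \<open>I \<times> \<omega>\<close> is stored as the pair \<open>(I, \<omega>)\<close>.\<close>

type_synonym tile = "real set \<times> real set"

definition is_tile :: "tile \<Rightarrow> bool" where
  "is_tile T \<longleftrightarrow> fst T \<in> dyadic_intervals \<and> (\<exists>\<theta>. snd T \<in> translated_dyadic \<theta>) \<and>
     len (fst T) * len (snd T) = 1"

type_synonym tri_tile = "tile \<times> tile \<times> tile"

definition is_tri_tile :: "tri_tile \<Rightarrow> bool" where
  "is_tri_tile P \<longleftrightarrow> (case P of (P1, P2, P3) \<Rightarrow>
     is_tile P1 \<and> is_tile P2 \<and> is_tile P3 \<and> fst P1 = fst P2 \<and> fst P2 = fst P3)"

definition tile1 :: "tri_tile \<Rightarrow> tile" where "tile1 P = fst P"
definition tile2 :: "tri_tile \<Rightarrow> tile" where "tile2 P = fst (snd P)"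
definition tile3 :: "tri_tile \<Rightarrow> tile" where "tile3 P = snd (snd P)"

definition spatial :: "tri_tile \<Rightarrow> real set" where
  "spatial P = fst (tile1 P)"

definition localize :: "tri_tile set \<Rightarrow> real set \<Rightarrow> tri_tile set" where
  "localize PP I0 = {P \<in> PP. spatial P \<subseteq> I0}"

text \<open>The collection \<open>\<P>(I\<^sub>0)\<^sup>+\<close>. Which tri-tile over \<open>I\<^sub>0\<close> is added is irrelevant
  below, since only spatial intervals of its members are used.\<close>

definition localize_plus :: "tri_tile set \<Rightarrow> real set \<Rightarrow> tri_tile set" where
  "localize_plus PP I0 =
     insert (SOME P. is_tri_tile P \<and> spatial P = I0) (localize PP I0)"

text \<open>Wave packets\<close>

definition iter_deriv :: "nat \<Rightarrow> (real \<Rightarrow> complex) \<Rightarrow> real \<Rightarrow> complex" where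
  "iter_deriv k \<phi> = ((\<lambda>g x. vector_derivative g (at x)) ^^ k) \<phi>"

definition smooth :: "(real \<Rightarrow> complex) \<Rightarrow> bool" where
  "smooth \<phi> \<longleftrightarrow> (\<forall>k x. iter_deriv k \<phi> differentiable (at x))"

definition fourier :: "(real \<Rightarrow> complex) \<Rightarrow> real \<Rightarrow> complex" where
  "fourier \<phi> \<xi> = (\<integral>x. \<phi> x * exp (- 2 * of_real pi * \<i> * of_real (x * \<xi>)) \<partial>lebesgue)"

text \<open>The constants \<open>C\<^sub>k\<^sub>,\<^sub>N\<close> are the parameter \<open>A\<close>, so that they can be shared by all wave
  packets of a family; \<open>K\<close> is the number of derivatives that are controlled.
  For \<open>K = 0\<close> only the size of \<open>\<phi>\<close> is controlled, and the condition is then invariant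
  under simultaneous modulation of \<open>\<phi>\<close> and translation of the frequency interval.\<close>

definition wave_packet ::
  "(nat \<Rightarrow> real \<Rightarrow> real) \<Rightarrow> nat \<Rightarrow> tile \<Rightarrow> (real \<Rightarrow> complex) \<Rightarrow> bool" where
  "wave_packet A K T \<phi> \<longleftrightarrow>
     smooth \<phi> \<and>
     closure {\<xi>. fourier \<phi> \<xi> \<noteq> 0} \<subseteq> dilate (9/10) (snd T) \<and>
     (\<forall>k\<le>K. \<forall>N>0. \<forall>x. cmod (iter_deriv k \<phi> x) \<le>
        A k N * len (fst T) powr (- 1/2 - real k)
          * (1 + infdist x (fst T) / len (fst T)) powr (- N))"

text \<open>The trilinear form. A sum that does not converge absolutely has the value \<open>0\<close> here; the
  theorem therefore also asserts convergence whenever its right-hand side is finite.\<close>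

definition pairing :: "(real \<Rightarrow> complex) \<Rightarrow> (real \<Rightarrow> complex) \<Rightarrow> complex" where
  "pairing f \<phi> = (\<integral>x. f x * cnj (\<phi> x) \<partial>lebesgue)"

definition form_term ::
  "(tri_tile \<Rightarrow> real \<Rightarrow> complex) \<Rightarrow> (tri_tile \<Rightarrow> real \<Rightarrow> complex) \<Rightarrow>
   (tri_tile \<Rightarrow> real \<Rightarrow> complex) \<Rightarrow> (real \<Rightarrow> complex) \<Rightarrow> (real \<Rightarrow> complex) \<Rightarrow>
   (real \<Rightarrow> complex) \<Rightarrow> tri_tile \<Rightarrow> complex" where
  "form_term \<phi>1 \<phi>2 \<phi>3 f g h P =
     of_real (len (spatial P) powr (- 1/2))
       * pairing f (\<phi>1 P) * pairing g (\<phi>2 P) * pairing h (\<phi>3 P)"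

definition form ::
  "(tri_tile \<Rightarrow> real \<Rightarrow> complex) \<Rightarrow> (tri_tile \<Rightarrow> real \<Rightarrow> complex) \<Rightarrow>
   (tri_tile \<Rightarrow> real \<Rightarrow> complex) \<Rightarrow> tri_tile set \<Rightarrow> (real \<Rightarrow> complex) \<Rightarrow>
   (real \<Rightarrow> complex) \<Rightarrow> (real \<Rightarrow> complex) \<Rightarrow> complex" where
  "form \<phi>1 \<phi>2 \<phi>3 PP f g h = (\<Sum>\<^sub>\<infinity>P\<in>PP. form_term \<phi>1 \<phi>2 \<phi>3 f g h P)"

text \<open>Averages. They are valued in \<open>ennreal\<close> because a locally integrable function may have
  \<open>\<integral>|f|\<^sup>s \<chi>\<^sub>I\<^sup>M = \<infinity>\<close>.\<close>

definition locally_integrable :: "(real \<Rightarrow> complex) \<Rightarrow> bool" where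
  "locally_integrable f \<longleftrightarrow> (\<forall>K. compact K \<longrightarrow> f absolutely_integrable_on K)"

definition chi :: "real set \<Rightarrow> real \<Rightarrow> real" where
  "chi J x = (1 + infdist x J / len J) powr (- 100)"

definition ennpow :: "ennreal \<Rightarrow> real \<Rightarrow> ennreal" where
  "ennpow a r = (if a = \<infinity> then \<infinity> else ennreal (enn2real a powr r))"
  \<comment> \<open>only used with \<open>r > 0\<close>\<close>

definition avg :: "real \<Rightarrow> real \<Rightarrow> (real \<Rightarrow> complex) \<Rightarrow> real set \<Rightarrow> ennreal" where
  "avg s m f J =
     ennreal (1 / len J) * (\<integral>\<^sup>+x. ennreal (cmod (f x) powr s * chi J x powr m) \<partial>lebesgue)"

text \<open>Sparse families\<close>

definition sparse_family :: "real \<Rightarrow> real set set \<Rightarrow> bool" where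
  "sparse_family \<eta> S \<longleftrightarrow> S \<subseteq> dyadic_intervals \<and>
     (\<exists>E. disjoint_family_on E S \<and>
        (\<forall>Q\<in>S. E Q \<subseteq> Q \<and> E Q \<in> sets lebesgue \<and> len (E Q) \<ge> \<eta> * len Q))"

text \<open>The local estimate with constant \<open>C\<close>, for one collection of tri-tiles, all dyadic
  intervals and all locally integrable functions. The theorem assumes it, with one constant, for
  all subcollections of the given collection: the stopping time argument behind sparse
  domination applies it to what remains of \<open>\<P>(Q)\<close> once the tri-tiles over the stopping
  intervals inside \<open>Q\<close> are removed, and this is not of the form \<open>\<P>(I\<^sub>0)\<close>.\<close>

definition local_estimate ::
  "real \<Rightarrow> real \<Rightarrow> real \<Rightarrow> real \<Rightarrow> real \<Rightarrow> (tri_tile \<Rightarrow> real \<Rightarrow> complex) \<Rightarrow>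
   (tri_tile \<Rightarrow> real \<Rightarrow> complex) \<Rightarrow> (tri_tile \<Rightarrow> real \<Rightarrow> complex) \<Rightarrow> tri_tile set \<Rightarrow> bool" where
  "local_estimate C s1 s2 s3 M \<phi>1 \<phi>2 \<phi>3 PP \<longleftrightarrow>
     (\<forall>I0\<in>dyadic_intervals. \<forall>f g h.
        locally_integrable f \<longrightarrow> locally_integrable g \<longrightarrow> locally_integrable h \<longrightarrow>
        ennreal (cmod (form \<phi>1 \<phi>2 \<phi>3 (localize PP I0) f g h)) \<le>
          ennreal C
          * ennpow (SUP P\<in>localize_plus PP I0. avg s1 M f (spatial P)) (1 / s1)
          * ennpow (SUP P\<in>localize_plus PP I0. avg s2 M g (spatial P)) (1 / s2)
          * ennpow (SUP P\<in>localize_plus PP I0. avg s3 M h (spatial P)) (1 / s3)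
          * ennreal (len I0))"

end

theory Submission
  imports Defs
begin

text \<open>A stopping time argument. Below a selected interval \<open>Q\<close> select the maximal dyadic \<open>R\<close> over which
  one of the three averages (with exponent \<open>M\<close>) exceeds \<open>960\<close> times the average (with exponent
  \<open>M - 1\<close>) over \<open>Q\<close>. Since \<open>chi R\<^sup>M \<le> chi R * chi Q\<^sup>M\<^sup>-\<^sup>1\<close>, the spare factor \<open>chi R\<close> turns a large
  average over \<open>R\<close> into a large average over some ball containing \<open>R\<close>, and the weak type bound for
  the maximal function, with constant \<open>80 = 960 / 12\<close>, shows that the selected \<open>R\<close> cover at most
  \<open>3/12\<close> of \<open>Q\<close>. The local estimate applies to the tri-tiles for which \<open>Q\<close> is the smallest selected
  interval above their spatial interval. It is used for finite collections only: the resulting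
  bounds for the partial sums are uniform, and they give the convergence of the form.\<close>

section \<open>Dyadic intervals: lengths, nesting, and finiteness between two scales\<close>

lemma dyadic_cases:
  assumes "Q \<in> dyadic_intervals"
  obtains k n :: int where "Q = {2 powi k * of_int n ..< 2 powi k * (of_int n + 1)}"
  using assms unfolding dyadic_intervals_def by blast

lemma len_dyadic: "len {2 powi k * of_int n ..< 2 powi k * (of_int n + 1)} = 2 powi k"
  by (simp add: algebra_simps)

lemma len_dyadic_pos: "Q \<in> dyadic_intervals \<Longrightarrow> 0 < len Q"
  by (erule dyadic_cases) (simp only: len_dyadic, simp)

lemma dyadic_sets: "Q \<in> dyadic_intervals \<Longrightarrow> Q \<in> sets lebesgue"
  by (erule dyadic_cases) simp

lemma dyadic_emeasure: "Q \<in> dyadic_intervals \<Longrightarrow> emeasure lebesgue Q = ennreal (len Q)"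
  by (erule dyadic_cases) (simp add: algebra_simps)

lemma dyadic_nonempty: "Q \<in> dyadic_intervals \<Longrightarrow> Q \<noteq> {}"
  by (erule dyadic_cases) (simp add: algebra_simps)

text \<open>The position is determined by the level \<open>k\<close> and any one point, so at each
  level at most one dyadic interval contains a given point.\<close>

lemma mem_dyadic_iff:
  "x \<in> {2 powi k * of_int n ..< 2 powi k * (of_int n + 1)} \<longleftrightarrow> n = \<lfloor>x / 2 powi k\<rfloor>" for x :: real
proof -
  have "(n = \<lfloor>x / 2 powi k\<rfloor>) \<longleftrightarrow> of_int n \<le> x / 2 powi k \<and> x / 2 powi k < of_int n + 1"
    by linarith
  then show ?thesis
    by (simp add: field_simps)
qed

lemma countable_dyadic: "countable dyadic_intervals"
proof -
  have "dyadic_intervals =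
    (\<lambda>(k, n). {2 powi k * of_int n ..< 2 powi k * (of_int n + 1)}) ` (UNIV :: (int \<times> int) set)"
    unfolding dyadic_intervals_def by auto
  then show ?thesis by (rule ssubst) (intro countable_image countableI_type)
qed

text \<open>In units of \<open>2 powi k\<close> all four endpoints are integers, because the coarser
  length is an integral multiple \<open>N\<close> of the finer one.\<close>

lemma dyadic_coarser:
  fixes x :: real and k l :: int
  assumes "k \<le> l" "x \<in> {2 powi k * of_int n ..< 2 powi k * (of_int n + 1)}"
    "x \<in> {2 powi l * of_int m ..< 2 powi l * (of_int m + 1)}"
  shows "{2 powi k * of_int n ..< 2 powi k * (of_int n + 1)}
     \<subseteq> {2 powi l * of_int m ..< 2 powi l * (of_int m + 1 :: real)}"
proof -
  define N :: int where "N = 2 ^ nat (l - k)"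
  define u :: real where "u = 2 powi k"
  have u: "0 < u" by (simp add: u_def)
  have eq: "2 powi l = u * of_int N"
  proof -
    have "(2::real) powi (k + (l - k)) = u * 2 powi (l - k)"
      unfolding u_def by (rule power_int_add) simp
    moreover have "(2::real) powi (l - k) = of_int N"
      unfolding N_def power_int_def using assms(1) by simp
    ultimately show ?thesis by simp
  qed
  have "u * of_int n \<le> x" "x < u * (of_int n + 1)" "u * of_int N * of_int m \<le> x"
    "x < u * of_int N * (of_int m + 1)"
    using assms(2,3) unfolding eq u_def[symmetric] by auto
  then have "u * of_int (N * m) < u * of_int (n + 1)" "u * of_int n < u * of_int (N * (m + 1))"
    by (auto simp: mult.assoc)
  then have "N * m < n + 1" "n < N * (m + 1)"
    using u by (simp_all only: mult_less_cancel_left_pos of_int_less_iff)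
  \<comment> \<open>Integrality: a strict inequality between integers gains 1, so a shared point
    forces the whole finer interval inside.\<close>
  then have "N * m \<le> n" "n + 1 \<le> N * (m + 1)" by auto
  then have "u * of_int (N * m) \<le> u * of_int n" "u * of_int (n + 1) \<le> u * of_int (N * (m + 1))"
    using u by (simp_all only: mult_le_cancel_left_pos of_int_le_iff)
  then show ?thesis
    unfolding eq u_def[symmetric] by (auto simp: mult.assoc)
qed

lemma dyadic_nested:
  assumes "Q \<in> dyadic_intervals" "R \<in> dyadic_intervals" "Q \<inter> R \<noteq> {}"
  shows "Q \<subseteq> R \<or> R \<subseteq> Q"
proof -
  obtain k n where Q: "Q = {2 powi k * of_int n ..< 2 powi k * (of_int n + 1)}"
    using dyadic_cases[OF assms(1)] .
  obtain l m where R: "R = {2 powi l * of_int m ..< 2 powi l * (of_int m + 1)}"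
    using dyadic_cases[OF assms(2)] .
  obtain x where x: "x \<in> Q" "x \<in> R" using assms(3) by blast
  show ?thesis
  proof (cases "k \<le> l")
    case True
    then show ?thesis using x unfolding Q R by (intro disjI1 dyadic_coarser)
  next
    case False
    then show ?thesis using x unfolding Q R by (intro disjI2 dyadic_coarser) auto
  qed
qed

lemma dyadic_level_mono:
  fixes k l n m :: int
  assumes "{2 powi k * of_int n ..< 2 powi k * (of_int n + 1)}
     \<subseteq> {2 powi l * of_int m ..< 2 powi l * (of_int m + 1 :: real)}"
  shows "k \<le> l"
proof -
  have "len {2 powi k * of_int n ..< 2 powi k * (of_int n + 1)}
      \<le> len {2 powi l * of_int m ..< 2 powi l * (of_int m + 1)}"
    using assms by (intro measure_mono_fmeasurable) (auto simp: fmeasurable_def)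
  then have "2 powi k \<le> (2 powi l :: real)" by (simp only: len_dyadic)
  then show ?thesis
    using power_int_strict_increasing[of l k "2::real"] by (meson not_le one_less_numeral_iff semiring_norm(76))
qed

text \<open>All these intervals contain a common point of \<open>Q\<close> and have levels between
  those of \<open>Q\<close> and \<open>R\<close>, so there is at most one per level. This supplies
  the maximal and minimal elements for the stopping construction.\<close>

lemma finite_dyadic_between:
  assumes "Q \<in> dyadic_intervals" "R \<in> dyadic_intervals"
  shows "finite {J \<in> dyadic_intervals. Q \<subseteq> J \<and> J \<subseteq> R}"
proof -
  obtain x where x: "x \<in> Q" using dyadic_nonempty[OF assms(1)] by blast
  obtain k n where Q: "Q = {2 powi k * of_int n ..< 2 powi k * (of_int n + 1)}"
    using dyadic_cases[OF assms(1)] .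
  obtain l m where R: "R = {2 powi l * of_int m ..< 2 powi l * (of_int m + 1)}"
    using dyadic_cases[OF assms(2)] .
  have "{J \<in> dyadic_intervals. Q \<subseteq> J \<and> J \<subseteq> R}
     \<subseteq> (\<lambda>i::int. let n = \<lfloor>x / 2 powi i\<rfloor> in {2 powi i * of_int n ..< 2 powi i * (of_int n + 1)}) ` {k..l}"
  proof safe
    fix J assume J: "J \<in> dyadic_intervals" "Q \<subseteq> J" "J \<subseteq> R"
    obtain i j where J': "J = {2 powi i * of_int j ..< 2 powi i * (of_int j + 1)}"
      using dyadic_cases[OF J(1)] .
    have "x \<in> J" using x J by blast
    then have "j = \<lfloor>x / 2 powi i\<rfloor>" unfolding J' mem_dyadic_iff .
    moreover have "i \<in> {k..l}"
      using J dyadic_level_mono unfolding J' Q R by auto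
    ultimately show "J \<in> (\<lambda>i::int. let n = \<lfloor>x / 2 powi i\<rfloor> in {2 powi i * of_int n ..< 2 powi i * (of_int n + 1)}) ` {k..l}"
      unfolding J' by (auto simp: Let_def)
  qed
  then show ?thesis by (rule finite_subset) simp
qed

section \<open>The weight \<open>chi\<close> and a weak type maximal bound\<close>

lemma chi_pos: "0 < chi J x"
  unfolding chi_def
  by (simp add: add_nonneg_eq_0_iff infdist_nonneg)

lemma chi_le_1: "chi J x \<le> 1"
proof -
  have "(1 + infdist x J / len J) powr (- 100) \<le> 1 powr (- 100)"
    by (intro powr_mono2') (auto simp: infdist_nonneg)
  then show ?thesis by (simp add: chi_def)
qed

lemma borel_measurable_chi [measurable]: "chi J \<in> borel_measurable borel"
proof -
  have [measurable]: "(\<lambda>x. infdist x J) \<in> borel_measurable borel"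
    by (intro borel_measurable_continuous_onI continuous_intros)
  show ?thesis unfolding chi_def[abs_def] by measurable
qed

text \<open>Enlarging the interval lessens the distance and increases the length, and the exponent
  is negative.\<close>

lemma chi_mono:
  assumes "I \<in> dyadic_intervals" "J \<in> dyadic_intervals" "I \<subseteq> J"
  shows "chi I x \<le> chi J x"
proof -
  have pos: "0 < len I" "0 < len J" using assms len_dyadic_pos by auto
  have "emeasure lebesgue I \<le> emeasure lebesgue J"
    using assms by (intro emeasure_mono dyadic_sets) auto
  then have "len I \<le> len J"
    using assms by (simp add: dyadic_emeasure)
  moreover have "infdist x J \<le> infdist x I"
    using assms dyadic_nonempty by (intro infdist_mono) auto
  ultimately have "infdist x J / len J \<le> infdist x I / len I"
    using pos by (intro frac_le) (auto simp: infdist_nonneg)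
  then show ?thesis
    unfolding chi_def by (intro powr_mono2') (auto simp: infdist_nonneg add_pos_nonneg)
qed

text \<open>The balls are concentric and double their radius at each step, so they resolve the tail of \<open>chi J\<close>.\<close>

lemma chi_le_suminf:
  assumes "J \<in> dyadic_intervals"
  shows "\<exists>c. J \<subseteq> cball c (len J) \<and>
    (\<forall>x. ennreal (chi J x) \<le>
       (\<Sum>k. ennreal (4 * (1/4) ^ k) * indicator (cball c (2 ^ k * len J)) x))"
proof -
  obtain k n where J: "J = {2 powi k * of_int n ..< 2 powi k * (of_int n + 1)}"
    using dyadic_cases[OF assms] .
  define l where "l = len J"
  define a where "a = 2 powi k * (of_int n :: real)"
  have l: "0 < l" using len_dyadic_pos[OF assms] by (simp add: l_def)
  have l': "l = 2 powi k" by (simp only: l_def J len_dyadic)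
  have J': "J = {a ..< a + l}" unfolding J l' a_def by (simp add: algebra_simps)
  \<comment> \<open>The midpoint; every point of \<open>J\<close> is within \<open>l / 2\<close> of
    it.\<close>
  define c where "c = a + l / 2"
  show ?thesis
  proof (intro exI conjI allI)
    show "J \<subseteq> cball c (len J)"
      unfolding l_def[symmetric] J' c_def using l by (auto simp: dist_real_def)
  next
    fix x
    let ?T = "\<lambda>k. ennreal (4 * (1/4) ^ k) * indicator (cball c (2 ^ k * len J)) x"
    obtain m where m: "\<bar>x - c\<bar> / l < 2 ^ m"
      using real_arch_pow[of 2 "\<bar>x - c\<bar> / l"] by auto
    \<comment> \<open>The first ball containing \<open>x\<close>; the term with this index alone
      dominates \<open>chi J x\<close>.\<close>
    define k where "k = (LEAST k. \<bar>x - c\<bar> \<le> 2 ^ k * l)"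
    have k: "\<bar>x - c\<bar> \<le> 2 ^ k * l"
      unfolding k_def by (rule LeastI[of _ m]) (use m l in \<open>simp add: field_simps\<close>)
    have "chi J x \<le> 4 * (1/4) ^ k"
    proof (cases k)
      case 0
      then show ?thesis using chi_le_1[of J x] by simp
    next
      case (Suc j)
      then have "\<not> \<bar>x - c\<bar> \<le> 2 ^ j * l"
        unfolding k_def using not_less_Least[of j "\<lambda>k. \<bar>x - c\<bar> \<le> 2 ^ k * l"] k_def by simp
      then have j: "2 ^ j * l < \<bar>x - c\<bar>" by simp
      have "\<bar>x - c\<bar> - l / 2 \<le> infdist x J"
        unfolding infdist_def using dyadic_nonempty[OF assms]
        by (auto intro!: cINF_greatest simp: J' c_def dist_real_def)
      then have "(2 ^ j - 1/2) * l \<le> infdist x J" using j by (simp add: algebra_simps)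
      then have "2 ^ j - 1/2 \<le> infdist x J / l" using l by (simp add: field_simps)
      then have *: "2 ^ j \<le> 1 + infdist x J / l" by simp
      have "chi J x \<le> (2 ^ j) powr (- 100)"
        unfolding chi_def l_def[symmetric] using * by (intro powr_mono2') auto
      \<comment> \<open>Exponent 2 gives weights that fall by 4 while the radii double, so weight
        times radius is summable. The shift from \<open>j\<close> to \<open>k = Suc j\<close>
        accounts for the factor 4.\<close>
      also have "\<dots> \<le> (2 ^ j) powr (- 2)"
        by (intro powr_mono) auto
      also have "\<dots> = inverse ((2 ^ j)\<^sup>2)"
        by (simp add: powr_minus powr_numeral)
      also have "((2::real) ^ j)\<^sup>2 = 4 ^ j"
        by (simp add: power2_eq_square flip: power_mult_distrib)
      also have "inverse ((4::real) ^ j) = 4 * (1/4) ^ k"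
        by (simp add: Suc power_one_over field_simps)
      finally show ?thesis .
    qed
    then have "ennreal (chi J x) \<le> ennreal (4 * (1/4) ^ k)"
      by (rule ennreal_leI)
    also have "\<dots> = ?T k"
    proof -
      have "x \<in> cball c (2 ^ k * len J)"
        unfolding mem_cball dist_real_def l_def[symmetric] abs_minus_commute[of c] by (rule k)
      then show ?thesis by simp
    qed
    also have "\<dots> = sum ?T {k}"
      by (simp only: sum.insert sum.empty finite.emptyI empty_iff not_False_eq_True add_0_right)
    also have "\<dots> \<le> (\<Sum>k. ?T k)"
      by (rule sum_le_suminf) auto
    finally show "ennreal (chi J x) \<le> (\<Sum>k. ?T k)" .
  qed
qed

text \<open>By contradiction: if each ball of radius \<open>2 ^ k * len J\<close> carried at most
  \<open>t / 8\<close> times its radius, the weighted terms would be at most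
  \<open>t * len J / 2 * (1/2) ^ k\<close> and add up to \<open>t * len J\<close>. This fixes the
  constant 8.\<close>

lemma large_ball_of_large_chi_integral:
  fixes w :: "real \<Rightarrow> ennreal"
  assumes J: "J \<in> dyadic_intervals" and [measurable]: "w \<in> borel_measurable lebesgue"
    and t: "0 < t" and "ennreal (t * len J) < (\<integral>\<^sup>+x. ennreal (chi J x) * w x \<partial>lebesgue)"
  shows "\<exists>c r. 0 < r \<and> J \<subseteq> cball c r \<and>
    ennreal (t * r / 8) < (\<integral>\<^sup>+x. w x * indicator (cball c r) x \<partial>lebesgue)"
proof -
  obtain c where c: "J \<subseteq> cball c (len J)" and
    le: "\<And>x. ennreal (chi J x) \<le>
       (\<Sum>k. ennreal (4 * (1/4) ^ k) * indicator (cball c (2 ^ k * len J)) x)"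
    using chi_le_suminf[OF J] by blast
  have l: "0 < len J" using len_dyadic_pos[OF J] .
  let ?I = "\<lambda>k. (\<integral>\<^sup>+x. w x * indicator (cball c (2 ^ k * len J)) x \<partial>lebesgue)"
  have "\<exists>k. ennreal (t * (2 ^ k * len J) / 8) < ?I k"
  proof (rule ccontr)
    assume "\<not> ?thesis"
    then have up: "?I k \<le> ennreal (t * (2 ^ k * len J) / 8)" for k
      by (simp add: not_less)
    have "(\<integral>\<^sup>+x. ennreal (chi J x) * w x \<partial>lebesgue) \<le>
       (\<integral>\<^sup>+x. (\<Sum>k. ennreal (4 * (1/4) ^ k) * (w x * indicator (cball c (2 ^ k * len J)) x)) \<partial>lebesgue)"
    proof (rule nn_integral_mono)
      fix x
      have "ennreal (chi J x) * w x \<le>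
        (\<Sum>k. ennreal (4 * (1/4) ^ k) * indicator (cball c (2 ^ k * len J)) x) * w x"
        by (intro mult_right_mono le) simp
      also have "\<dots> = (\<Sum>k. ennreal (4 * (1/4) ^ k) * indicator (cball c (2 ^ k * len J)) x * w x)"
        by (rule ennreal_suminf_multc[symmetric])
      finally show "ennreal (chi J x) * w x \<le>
        (\<Sum>k. ennreal (4 * (1/4) ^ k) * (w x * indicator (cball c (2 ^ k * len J)) x))"
        by (simp add: ac_simps)
    qed
    also have "\<dots> = (\<Sum>k. ennreal (4 * (1/4) ^ k) * ?I k)"
    proof -
      have [measurable]: "(\<lambda>x. w x * indicator (cball c (2 ^ k * len J)) x) \<in> borel_measurable lebesgue" for k
        by (intro borel_measurable_times_ennreal borel_measurable_indicator) auto
      show ?thesis by (subst nn_integral_suminf) (auto simp: nn_integral_cmult)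
    qed
    also have "\<dots> \<le> (\<Sum>k. ennreal (t * len J / 2 * (1/2) ^ k))"
    proof (intro suminf_le allI)
      fix k
      have "ennreal (4 * (1/4) ^ k) * ?I k \<le> ennreal (4 * (1/4) ^ k) * ennreal (t * (2 ^ k * len J) / 8)"
        by (intro mult_left_mono up) simp
      also have "\<dots> = ennreal (4 * (1/4) ^ k * (t * (2 ^ k * len J) / 8))"
        using t by (intro ennreal_mult[symmetric]) auto
      also have "4 * (1/4) ^ k * (t * (2 ^ k * len J) / 8) = t * len J / 2 * ((1/4) ^ k * 2 ^ k)"
        by simp
      also have "(1/4) ^ k * 2 ^ k = (1/2 :: real) ^ k"
        by (simp flip: power_mult_distrib)
      finally show "ennreal (4 * (1/4) ^ k) * ?I k \<le> ennreal (t * len J / 2 * (1/2) ^ k)" .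
    qed auto
    also have "\<dots> = ennreal (t * len J)"
    proof (rule suminf_ennreal_eq)
      show "(\<lambda>k. t * len J / 2 * (1/2) ^ k) sums (t * len J)"
        using sums_mult[OF geometric_sums[of "1/2::real"], of "t * len J / 2"] by simp
    qed (use t in auto)
    finally show False using assms(4) by simp
  qed
  then obtain k where k: "ennreal (t * (2 ^ k * len J) / 8) < ?I k" ..
  have "1 * len J \<le> 2 ^ k * len J" by (intro mult_right_mono) auto
  then have "cball c (len J) \<subseteq> cball c (2 ^ k * len J)" by (intro subset_cball) simp
  with c l k show ?thesis by (intro exI[of _ c] exI[of _ "2 ^ k * len J"]) auto
qed

text \<open>Vitali's lemma selects disjoint balls whose fivefold enlargements cover the union. An
  enlarged ball has length \<open>10 * r\<close>, and the mass of the selected ball exceeds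
  \<open>t * r / 8\<close>, whence \<open>80 = 10 * 8\<close>; disjointness bounds the total mass by
  \<open>I\<close>.\<close>

lemma chi_weak_type:
  fixes w :: "real \<Rightarrow> ennreal"
  assumes "\<J> \<subseteq> dyadic_intervals" and [measurable]: "w \<in> borel_measurable lebesgue"
    and t: "0 < t" and I: "0 \<le> I" "(\<integral>\<^sup>+x. w x \<partial>lebesgue) = ennreal I"
    and J: "\<And>J. J \<in> \<J> \<Longrightarrow> ennreal (t * len J) < (\<integral>\<^sup>+x. ennreal (chi J x) * w x \<partial>lebesgue)"
  shows "emeasure lebesgue (\<Union>\<J>) \<le> ennreal (80 * I / t)"
proof -
  have "\<forall>J\<in>\<J>. \<exists>c r. 0 < r \<and> J \<subseteq> cball c r \<and>
    ennreal (t * r / 8) < (\<integral>\<^sup>+x. w x * indicator (cball c r) x \<partial>lebesgue)"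
    using large_ball_of_large_chi_integral assms by blast
  then obtain c r where cr: "\<And>J. J \<in> \<J> \<Longrightarrow> 0 < r J" "\<And>J. J \<in> \<J> \<Longrightarrow> J \<subseteq> cball (c J) (r J)"
    "\<And>J. J \<in> \<J> \<Longrightarrow>
       ennreal (t * r J / 8) < (\<integral>\<^sup>+x. w x * indicator (cball (c J) (r J)) x \<partial>lebesgue)"
    by metis
  \<comment> \<open>The mass of a ball is at most \<open>I\<close>, so the radii are uniformly
    bounded, as Vitali's lemma requires.\<close>
  have "r J \<le> 8 * I / t" if "J \<in> \<J>" for J
  proof -
    have "ennreal (t * r J / 8) \<le> (\<integral>\<^sup>+x. w x * indicator (cball (c J) (r J)) x \<partial>lebesgue)"
      using cr(3)[OF that] by simp
    also have "\<dots> \<le> ennreal I"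
      unfolding I(2)[symmetric] by (intro nn_integral_mono) (auto split: split_indicator)
    finally have "t * r J / 8 \<le> I" using I(1) by simp
    then show ?thesis using t by (simp add: field_simps)
  qed
  then have r: "\<And>J. J \<in> \<J> \<Longrightarrow> 0 < r J \<and> r J \<le> 8 * I / t"
    using cr(1) by blast
  have sub: "\<Union>\<J> \<subseteq> (\<Union>J\<in>\<J>. cball (c J) (r J))" using cr(2) by blast
  obtain C where C: "countable C" "C \<subseteq> \<J>"
    "pairwise (\<lambda>i j. disjnt (cball (c i) (r i)) (cball (c j) (r j))) C"
    "\<Union>\<J> \<subseteq> (\<Union>i\<in>C. cball (c i) (5 * r i))"
    by (rule Vitali_covering_lemma_cballs[OF sub r]) blast+
  have "emeasure lebesgue (\<Union>\<J>) \<le> emeasure lebesgue (\<Union>i\<in>C. cball (c i) (5 * r i))"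
    using C by (intro emeasure_mono sets.countable_UN') auto
  also have "\<dots> \<le> (\<integral>\<^sup>+i. emeasure lebesgue (cball (c i) (5 * r i)) \<partial>count_space C)"
  proof -
    have "emeasure lebesgue (\<Union>i\<in>C. cball (c i) (5 * r i))
      = (\<integral>\<^sup>+x. indicator (\<Union>i\<in>C. cball (c i) (5 * r i)) x \<partial>lebesgue)"
      using C(1) by (intro nn_integral_indicator[symmetric] sets.countable_UN') auto
    \<comment> \<open>At a point of the union at least one indicator equals 1; exchanging the
      integrals afterwards gives countable subadditivity.\<close>
    also have "\<dots> \<le> (\<integral>\<^sup>+x. \<integral>\<^sup>+i. indicator (cball (c i) (5 * r i)) x \<partial>count_space C \<partial>lebesgue)"
    proof (rule nn_integral_mono)
      fix x
      show "indicator (\<Union>i\<in>C. cball (c i) (5 * r i)) x \<le>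
        (\<integral>\<^sup>+i. (indicator (cball (c i) (5 * r i)) x :: ennreal) \<partial>count_space C)"
      proof (cases "x \<in> (\<Union>i\<in>C. cball (c i) (5 * r i))")
        case True
        then obtain i where i: "i \<in> C" "x \<in> cball (c i) (5 * r i)" by blast
        have "(1::ennreal) = (\<integral>\<^sup>+j. indicator {i} j \<partial>count_space C)"
          using i by simp
        also have "\<dots> \<le> (\<integral>\<^sup>+i. indicator (cball (c i) (5 * r i)) x \<partial>count_space C)"
          using i by (intro nn_integral_mono) (auto split: split_indicator)
        finally show ?thesis using True by simp
      qed simp
    qed
    also have "\<dots> = (\<integral>\<^sup>+i. \<integral>\<^sup>+x. indicator (cball (c i) (5 * r i)) x \<partial>lebesgue \<partial>count_space C)"
      using C(1) by (intro nn_integral_count_space_nn_integral borel_measurable_indicator) auto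
    finally show ?thesis by simp
  qed
  also have "\<dots> \<le> (\<integral>\<^sup>+i. ennreal (80 / t) *
      emeasure (density lebesgue w) (cball (c i) (r i)) \<partial>count_space C)"
  proof (rule nn_integral_mono)
    fix i assume "i \<in> space (count_space C)"
    then have i: "i \<in> \<J>" using C by auto
    have "emeasure lebesgue (cball (c i) (5 * r i)) = ennreal (10 * r i)"
      using cr(1)[OF i] by (simp add: cball_eq_atLeastAtMost)
    also have "\<dots> = ennreal (80 / t) * ennreal (t * r i / 8)"
      using t cr(1)[OF i] by (subst ennreal_mult[symmetric]) auto
    also have "\<dots> \<le> ennreal (80 / t) * emeasure (density lebesgue w) (cball (c i) (r i))"
      using cr(3)[OF i] by (intro mult_left_mono) (auto simp: emeasure_density)
    finally show "emeasure lebesgue (cball (c i) (5 * r i)) \<le>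
      ennreal (80 / t) * emeasure (density lebesgue w) (cball (c i) (r i))" .
  qed
  also have "\<dots> = ennreal (80 / t) *
      (\<integral>\<^sup>+i. emeasure (density lebesgue w) (cball (c i) (r i)) \<partial>count_space C)"
    by (rule nn_integral_cmult) simp
  \<comment> \<open>The selected balls are disjoint, so their masses add up in the measure with
    density \<open>w\<close>.\<close>
  also have "(\<integral>\<^sup>+i. emeasure (density lebesgue w) (cball (c i) (r i)) \<partial>count_space C)
      = emeasure (density lebesgue w) (\<Union>i\<in>C. cball (c i) (r i))"
    using C by (intro emeasure_UN_countable[symmetric])
      (auto simp: disjoint_family_on_def pairwise_def disjnt_def)
  also have "ennreal (80 / t) * \<dots> \<le> ennreal (80 / t) * ennreal I"
  proof (intro mult_left_mono)
    have "emeasure (density lebesgue w) (\<Union>i\<in>C. cball (c i) (r i)) \<le> emeasure (density lebesgue w) UNIV"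
      by (intro emeasure_mono) auto
    also have "\<dots> = ennreal I" using I(2) by (simp add: emeasure_density)
    finally show "emeasure (density lebesgue w) (\<Union>i\<in>C. cball (c i) (r i)) \<le> ennreal I" .
  qed simp
  also have "\<dots> = ennreal (80 * I / t)"
    using I(1) t by (subst ennreal_mult[symmetric]) auto
  finally show ?thesis .
qed

section \<open>Stopping families of dyadic intervals and their sparseness\<close>

text \<open>The intervals \<open>[0, 2\<^sup>k)\<close> and \<open>[-2\<^sup>k, 0)\<close>. Together they contain every dyadic interval, so
  they start the stopping time argument even when \<open>\<P>\<close> has no maximal spatial intervals.\<close>

definition tower :: "real set set" where
  "tower = {{2 powi k * of_int n ..< 2 powi k * (of_int n + 1)} | k n :: int. n \<in> {-1, 0}}"

lemma tower_dyadic: "Q \<in> tower \<Longrightarrow> Q \<in> dyadic_intervals"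
  unfolding tower_def dyadic_intervals_def by blast

text \<open>Once \<open>2 powi l\<close> exceeds the distance from the origin to the left endpoint
  and \<open>l\<close> is at least the level of \<open>P\<close>, the tower interval of level
  \<open>l\<close> on the side of that endpoint contains the endpoint, and hence \<open>P\<close> by
  nesting.\<close>

lemma ex_tower_superset:
  assumes "P \<in> dyadic_intervals"
  shows "\<exists>Q\<in>tower. P \<subseteq> Q"
proof -
  obtain k n where P: "P = {2 powi k * of_int n ..< 2 powi k * (of_int n + 1)}"
    using dyadic_cases[OF assms] .
  define x where "x = 2 powi k * (of_int n :: real)"
  have x: "x \<in> P" by (simp add: P x_def)
  obtain m where m: "\<bar>x\<bar> / 2 powi k < 2 ^ m"
    using real_arch_pow[of 2 "\<bar>x\<bar> / 2 powi k"] by auto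
  define l where "l = k + int m"
  have "2 powi l = 2 powi k * (2::real) ^ m"
    unfolding l_def by (simp add: power_int_add)
  then have l: "\<bar>x\<bar> < 2 powi l" using m by (simp add: field_simps)
  define j :: int where "j = (if 0 \<le> x then 0 else -1)"
  have "x \<in> {2 powi l * of_int j ..< 2 powi l * (of_int j + 1)}"
    using l by (auto simp: j_def)
  then have "P \<subseteq> {2 powi l * of_int j ..< 2 powi l * (of_int j + 1)}"
    using x unfolding P by (intro dyadic_coarser) (auto simp: l_def)
  moreover have "{2 powi l * of_int j ..< 2 powi l * (of_int j + 1)} \<in> tower"
    unfolding tower_def by (rule CollectI, rule exI[of _ l], rule exI[of _ j]) (simp add: j_def)
  ultimately show ?thesis by blast
qed

text \<open>Only a tower interval can contain further tower intervals, and the smaller ones all lie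
  in the half of it next to the origin.\<close>

lemma tower_below_half:
  assumes "Q \<in> dyadic_intervals"
  shows "emeasure lebesgue (\<Union>{R \<in> tower. R \<subset> Q}) \<le> ennreal (len Q / 2)"
proof -
  obtain k n where Q: "Q = {2 powi k * of_int n ..< 2 powi k * (of_int n + 1)}"
    using dyadic_cases[OF assms] .
  define u :: real where "u = 2 powi (k - 1)"
  have u: "0 < u" by (simp add: u_def)
  have k: "2 powi k = 2 * u"
    unfolding u_def by (simp add: power_int_diff)
  have len: "len Q = 2 * u" unfolding k[symmetric] by (simp only: Q len_dyadic)
  define H where "H = (if n = 0 then {0 ..< u} else if n = -1 then {- u ..< 0} else {})"
  have "\<Union>{R \<in> tower. R \<subset> Q} \<subseteq> H"
  proof (rule subsetI)
    fix x assume "x \<in> \<Union>{R \<in> tower. R \<subset> Q}"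
    then obtain R where x: "x \<in> R" and R: "R \<in> tower" "R \<subset> Q" by blast
    obtain l j where R': "R = {2 powi l * of_int j ..< 2 powi l * (of_int j + 1)}" and j: "j \<in> {-1, 0}"
      using R(1) unfolding tower_def by blast
    have lk: "l \<le> k"
      using R(2) dyadic_level_mono unfolding Q R' by blast
    \<comment> \<open>Raising the level from \<open>l\<close> to \<open>k\<close> keeps the side of
      the origin. The enlarged interval then shares with \<open>Q\<close> both a level and the point
      \<open>x\<close>, so the two coincide.\<close>
    have sub: "{2 powi l * of_int j ..< 2 powi l * (of_int j + 1)}
      \<subseteq> {2 powi k * of_int j ..< 2 powi k * (of_int j + 1 :: real)}"
    proof (rule dyadic_coarser[OF lk])
      \<comment> \<open>The left endpoint of the finer interval.\<close>
      let ?y = "if j = 0 then 0 else - (2 powi l :: real)"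
      show "?y \<in> {2 powi l * of_int j ..< 2 powi l * (of_int j + 1)}"
        using j by auto
      have "2 powi l \<le> (2 powi k :: real)" using lk by (intro power_int_increasing) auto
      then show "?y \<in> {2 powi k * of_int j ..< 2 powi k * (of_int j + 1)}"
        using j by auto
    qed
    have xQ: "x \<in> {2 powi k * of_int n ..< 2 powi k * (of_int n + 1)}"
      using x R(2) unfolding Q by blast
    have xj: "x \<in> {2 powi k * of_int j ..< 2 powi k * (of_int j + 1)}"
      using x sub unfolding R' by blast
    have nj: "n = j" using xQ xj unfolding mem_dyadic_iff by simp
    then have "l \<noteq> k" using R(2) unfolding Q R' by blast
    then have "2 powi l \<le> u"
      unfolding u_def using lk by (intro power_int_increasing) auto
    then show "x \<in> H"
      using j x unfolding R' H_def nj by auto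
  qed
  then have "emeasure lebesgue (\<Union>{R \<in> tower. R \<subset> Q}) \<le> emeasure lebesgue H"
    by (intro emeasure_mono) (auto simp: H_def)
  also have "\<dots> \<le> ennreal u" using u by (auto simp: H_def)
  finally show ?thesis by (simp add: len)
qed

definition stopping_children :: "(real set \<Rightarrow> real set \<Rightarrow> bool) \<Rightarrow> real set \<Rightarrow> real set set" where
  "stopping_children stop Q = {R \<in> dyadic_intervals. R \<subset> Q \<and> stop Q R \<and>
     (\<forall>J\<in>dyadic_intervals. R \<subset> J \<and> J \<subset> Q \<longrightarrow> \<not> stop Q J)}"

text \<open>There is no single root: the tower is the start, its two chains are infinite, and one
  interval may be reached along several chains of children.\<close>

inductive_set stopping_family :: "(real set \<Rightarrow> real set \<Rightarrow> bool) \<Rightarrow> real set set"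
  for stop :: "real set \<Rightarrow> real set \<Rightarrow> bool" where
  top: "Q \<in> tower \<Longrightarrow> Q \<in> stopping_family stop"
| child: "Q \<in> stopping_family stop \<Longrightarrow> R \<in> stopping_children stop Q \<Longrightarrow> R \<in> stopping_family stop"

lemma stopping_family_dyadic: "Q \<in> stopping_family stop \<Longrightarrow> Q \<in> dyadic_intervals"
  by (induction rule: stopping_family.induct) (auto simp: tower_dyadic stopping_children_def)

text \<open>Only finitely many dyadic intervals lie between \<open>R\<close> and \<open>Q\<close>,
  so among the stopped ones a maximal one exists.\<close>

lemma ex_stopping_child:
  assumes "Q \<in> dyadic_intervals" "R \<in> dyadic_intervals" "R \<subset> Q" "stop Q R"
  shows "\<exists>J\<in>stopping_children stop Q. R \<subseteq> J"
proof -
  let ?A = "{J \<in> {J \<in> dyadic_intervals. R \<subseteq> J \<and> J \<subseteq> Q}. J \<subset> Q \<and> stop Q J}"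
  have "finite ?A"
    by (rule finite_subset[OF _ finite_dyadic_between[OF assms(2,1)]]) auto
  moreover have "R \<in> ?A" using assms by auto
  ultimately obtain J where J: "J \<in> ?A" "\<And>J'. J' \<in> ?A \<Longrightarrow> J \<subseteq> J' \<Longrightarrow> J = J'"
    using finite_has_maximal[of ?A] by (metis (no_types, lifting) empty_iff)
  have "\<not> stop Q J'" if J': "J' \<in> dyadic_intervals" "J \<subset> J'" "J' \<subset> Q" for J'
  proof
    assume "stop Q J'"
    moreover have "R \<subseteq> J'" using J(1) J'(2) by auto
    ultimately have "J' \<in> ?A" using J' by simp
    then show False using J(2)[of J'] J'(2) by blast
  qed
  then have "J \<in> stopping_children stop Q"
    using J(1) by (simp add: stopping_children_def)
  then show ?thesis using J(1) by auto
qed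

text \<open>Both \<open>R0\<close> and \<open>Q\<close> contain \<open>R\<close>, so they are
  nested. If \<open>Q\<close> were strictly inside \<open>R0\<close>, a child of \<open>R0\<close>
  would lie above \<open>Q\<close>, hence strictly above \<open>R\<close>, against the maximality of
  \<open>R\<close> among the stopped intervals below \<open>R0\<close>.\<close>

lemma below_stopping_child_step:
  assumes "R \<in> stopping_children stop R0" "R0 \<in> dyadic_intervals" "Q \<in> dyadic_intervals"
    and "R0 \<subset> Q \<Longrightarrow> \<exists>J\<in>stopping_children stop Q. R0 \<subseteq> J"
    and "Q \<subset> R0 \<Longrightarrow> \<exists>J\<in>stopping_children stop R0. Q \<subseteq> J"
    and "R \<subset> Q"
  shows "\<exists>J\<in>stopping_children stop Q. R \<subseteq> J"
proof -
  have R: "R \<in> dyadic_intervals" "R \<subset> R0"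
    and max: "\<And>J. J \<in> dyadic_intervals \<Longrightarrow> R \<subset> J \<Longrightarrow> J \<subset> R0 \<Longrightarrow> \<not> stop R0 J"
    using assms(1) by (auto simp: stopping_children_def)
  have "R0 \<inter> Q \<noteq> {}" using R assms(6) dyadic_nonempty[OF R(1)] by blast
  then have "R0 \<subseteq> Q \<or> Q \<subseteq> R0" by (rule dyadic_nested[OF assms(2,3)])
  then consider "R0 = Q" | "R0 \<subset> Q" | "Q \<subset> R0" by blast
  then show ?thesis
  proof cases
    case 1
    then show ?thesis using assms(1) by blast
  next
    case 2
    then obtain J where "J \<in> stopping_children stop Q" "R0 \<subseteq> J" using assms(4) by metis
    with R(2) show ?thesis by blast
  next
    case 3
    then obtain J where J: "J \<in> stopping_children stop R0" "Q \<subseteq> J" using assms(5) by metis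
    then have "J \<in> dyadic_intervals" "J \<subset> R0" "stop R0 J" by (auto simp: stopping_children_def)
    moreover have "R \<subset> J" using assms(6) J(2) by simp
    ultimately show ?thesis using max by metis
  qed
qed

text \<open>Proved together with its mirror image by two nested inductions, since the step for a
  child of \<open>R0\<close> uses the claim for \<open>R0\<close> and \<open>Q\<close> in both
  orders. The assumption that tower intervals are stopped starts both inductions.\<close>

lemma nested_below_stopping_child:
  assumes tower: "\<And>Q R. R \<in> tower \<Longrightarrow> stop Q R"
    and "Q \<in> stopping_family stop" "R \<in> stopping_family stop" "R \<subset> Q"
  shows "\<exists>J\<in>stopping_children stop Q. R \<subseteq> J"
proof -
  let ?B = "\<lambda>Q R. R \<subset> Q \<longrightarrow> (\<exists>J\<in>stopping_children stop Q. R \<subseteq> J)"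
  note D = stopping_family_dyadic
  have top: "?B Q R" if "R \<in> tower" "Q \<in> stopping_family stop" for Q R
    using that ex_stopping_child[of Q R stop] tower D tower_dyadic by blast
  \<comment> \<open>Passes from one order to the other: with \<open>R\<close> fixed,
    \<open>?B R Q\<close> follows by induction on \<open>Q\<close>.\<close>
  have inner: "?B R Q" if R: "R \<in> stopping_family stop"
    and up: "\<And>Q. Q \<in> stopping_family stop \<Longrightarrow> ?B Q R"
    and "Q \<in> stopping_family stop" for Q R
    using that(3)
  proof induction
    case (top Q)
    then show ?case using \<open>\<And>Q R. R \<in> tower \<Longrightarrow> Q \<in> stopping_family stop \<Longrightarrow> ?B Q R\<close> R by blast
  next
    case (child Q0 Q)
    show ?case
      using below_stopping_child_step[OF child(2) D[OF child(1)] D[OF R]] child(3) up[OF child(1)]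
      by blast
  qed
  have "\<forall>Q\<in>stopping_family stop. ?B Q R \<and> ?B R Q"
    using assms(3)
  proof induction
    case (top R)
    then show ?case
      using inner \<open>\<And>Q R. R \<in> tower \<Longrightarrow> Q \<in> stopping_family stop \<Longrightarrow> ?B Q R\<close>
        stopping_family.top by blast
  next
    case (child R0 R)
    have "?B Q R" if "Q \<in> stopping_family stop" for Q
      using below_stopping_child_step[OF child(2) D[OF child(1)] D[OF that]] child(3) that
      by blast
    then show ?case
      using inner stopping_family.child[OF child(1,2)] by blast
  qed
  then show ?thesis using assms by blast
qed

text \<open>The part of \<open>Q\<close> outside its children serves as \<open>E Q\<close>: it
  misses every smaller member, since each lies in a child, and the children fill at most a
  \<open>1 - \<eta>\<close> share of \<open>Q\<close>.\<close>

lemma sparse_stopping_family: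
  assumes tower: "\<And>Q R. R \<in> tower \<Longrightarrow> stop Q R"
    and small: "\<And>Q. Q \<in> dyadic_intervals \<Longrightarrow>
      emeasure lebesgue (\<Union>{R \<in> dyadic_intervals. R \<subset> Q \<and> stop Q R}) \<le> ennreal ((1 - \<eta>) * len Q)"
    and \<eta>: "\<eta> \<le> 1"
  shows "sparse_family \<eta> (stopping_family stop)"
proof -
  define E where "E = (\<lambda>Q. Q - \<Union>(stopping_children stop Q))"
  have "disjoint_family_on E (stopping_family stop)"
    unfolding disjoint_family_on_def
  proof (intro ballI impI)
    fix Q R assume QR: "Q \<in> stopping_family stop" "R \<in> stopping_family stop" "Q \<noteq> R"
    have "Q \<inter> R \<noteq> {} \<Longrightarrow> Q \<subseteq> R \<or> R \<subseteq> Q"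
      using QR by (intro dyadic_nested stopping_family_dyadic)
    with QR(3) consider "Q \<inter> R = {}" | "R \<subset> Q" | "Q \<subset> R" by blast
    then show "E Q \<inter> E R = {}"
    proof cases
      case 2
      then have "\<exists>J\<in>stopping_children stop Q. R \<subseteq> J"
        using tower QR by (intro nested_below_stopping_child)
      then show ?thesis unfolding E_def by blast
    next
      case 3
      then have "\<exists>J\<in>stopping_children stop R. Q \<subseteq> J"
        using tower QR by (intro nested_below_stopping_child)
      then show ?thesis unfolding E_def by blast
    qed (auto simp: E_def)
  qed
  moreover have "E Q \<subseteq> Q \<and> E Q \<in> sets lebesgue \<and> len (E Q) \<ge> \<eta> * len Q"
    if "Q \<in> stopping_family stop" for Q
  proof -
    have Q: "Q \<in> dyadic_intervals" using that by (rule stopping_family_dyadic)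
    let ?U = "\<Union>(stopping_children stop Q)" and ?V = "\<Union>{R \<in> dyadic_intervals. R \<subset> Q \<and> stop Q R}"
    have meas: "\<Union>\<A> \<in> sets lebesgue" if "\<A> \<subseteq> dyadic_intervals" for \<A>
      using that dyadic_sets countable_subset[OF that countable_dyadic]
      by (intro sets.countable_Union) auto
    have U: "?U \<in> sets lebesgue" "?U \<subseteq> Q"
      by (intro meas) (auto simp: stopping_children_def)
    have "emeasure lebesgue ?U \<le> emeasure lebesgue ?V"
      by (intro emeasure_mono meas) (auto simp: stopping_children_def)
    then have le: "emeasure lebesgue ?U \<le> ennreal ((1 - \<eta>) * len Q)"
      using small[OF Q] by order
    then have "len ?U \<le> (1 - \<eta>) * len Q"
      unfolding measure_def using \<eta> len_dyadic_pos[OF Q]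
      by (intro enn2real_leI) (auto simp: measure_def)
    moreover have "len (E Q) = len Q - len ?U"
      unfolding E_def using U dyadic_sets[OF Q] dyadic_emeasure[OF Q]
      by (intro measure_Diff) auto
    ultimately show ?thesis
      using U dyadic_sets[OF Q] by (auto simp: E_def algebra_simps)
  qed
  ultimately show ?thesis
    unfolding sparse_family_def using stopping_family_dyadic by blast
qed

text \<open>A minimal member above \<open>P\<close> works: if \<open>P\<close> were stopped and
  strictly smaller, a child would be a still smaller member above \<open>P\<close>.\<close>

lemma ex_stopping_interval:
  assumes P: "P \<in> dyadic_intervals"
  shows "\<exists>Q\<in>stopping_family stop. P \<subseteq> Q \<and> (P = Q \<or> \<not> stop Q P)"
proof -
  obtain T where T: "T \<in> tower" "P \<subseteq> T" using ex_tower_superset[OF P] by blast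
  \<comment> \<open>Restricting to intervals below one tower interval \<open>T\<close> leaves
    finitely many candidates.\<close>
  let ?A = "{J \<in> {J \<in> dyadic_intervals. P \<subseteq> J \<and> J \<subseteq> T}. J \<in> stopping_family stop}"
  have "finite ?A"
    by (rule finite_subset[OF _ finite_dyadic_between[OF P tower_dyadic[OF T(1)]]]) auto
  moreover have "T \<in> ?A" using T stopping_family.top tower_dyadic by blast
  ultimately obtain Q where Q: "Q \<in> ?A" "\<And>J. J \<in> ?A \<Longrightarrow> J \<subseteq> Q \<Longrightarrow> Q = J"
    using finite_has_minimal[of ?A] by (metis (no_types, lifting) empty_iff)
  have "\<not> stop Q P" if ne: "P \<noteq> Q"
  proof
    assume "stop Q P"
    then obtain J where J: "J \<in> stopping_children stop Q" "P \<subseteq> J"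
      using ex_stopping_child[of Q P stop] P Q(1) ne by blast
    then have "J \<in> stopping_family stop" "J \<subset> Q" "J \<in> dyadic_intervals"
      using Q(1) stopping_family.child by (auto simp: stopping_children_def)
    then show False using Q J by blast
  qed
  then show ?thesis using Q(1) by blast
qed

section \<open>Large averages occupy a small part of \<open>Q\<close>\<close>

lemma locally_integrable_measurable:
  assumes "locally_integrable f"
  shows "f \<in> borel_measurable lebesgue"
proof (rule borel_measurable_LIMSEQ_metric)
  fix n :: nat
  have "f absolutely_integrable_on cball 0 (real n)"
    using assms by (auto simp: locally_integrable_def)
  then show "(\<lambda>x. indicator (cball 0 (real n)) x *\<^sub>R f x) \<in> borel_measurable lebesgue"
    by (simp add: set_integrable_def)
next
  fix x
  obtain N where N: "\<bar>x\<bar> \<le> real N" using real_arch_simple by blast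
  have "eventually (\<lambda>n. indicator (cball 0 (real n)) x *\<^sub>R f x = f x) sequentially"
    using N by (intro eventually_sequentiallyI[of N]) (auto simp: dist_real_def)
  then show "(\<lambda>n. indicator (cball 0 (real n)) x *\<^sub>R f x) \<longlonglongrightarrow> f x"
    by (rule tendsto_eventually)
qed

text \<open>The weak type bound is applied with \<open>w\<close> the integrand of the average over
  \<open>Q\<close>. The threshold is 960 times that average, so at most the share
  \<open>80 / 960 = 1 / 12\<close> of \<open>Q\<close> is covered.\<close>

lemma large_average_small:
  assumes f: "locally_integrable f" and M: "1 \<le> M" and Q: "Q \<in> dyadic_intervals"
  shows "emeasure lebesgue (\<Union>{R \<in> dyadic_intervals. R \<subset> Q \<and>
      ennreal 960 * avg s (M - 1) f Q < avg s M f R}) \<le> ennreal (len Q / 12)"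
    (is "emeasure lebesgue (\<Union>?J) \<le> _")
proof -
  have [measurable]: "f \<in> borel_measurable lebesgue"
    using f by (rule locally_integrable_measurable)
  have [measurable]: "chi J \<in> borel_measurable lebesgue" for J
    using measurable_completion[of "chi J" lborel borel] by simp
  define w where "w = (\<lambda>x. ennreal (cmod (f x) powr s * chi Q x powr (M - 1)))"
  have [measurable]: "w \<in> borel_measurable lebesgue" unfolding w_def by measurable
  have l: "0 < len Q" using len_dyadic_pos[OF Q] .
  have avgQ: "avg s (M - 1) f Q = ennreal (1 / len Q) * (\<integral>\<^sup>+x. w x \<partial>lebesgue)"
    by (simp add: avg_def w_def)
  have avgR: "avg s M f R \<le> ennreal (1 / len R) * (\<integral>\<^sup>+x. ennreal (chi R x) * w x \<partial>lebesgue)"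
    if "R \<in> dyadic_intervals" "R \<subset> Q" for R
    unfolding avg_def
  proof (intro mult_left_mono nn_integral_mono)
    fix x
    \<comment> \<open>One power of \<open>chi R\<close> is kept for the maximal bound and the other
      \<open>M - 1\<close> are enlarged to \<open>chi Q\<close>; \<open>1 \<le> M\<close> makes that
      exponent nonnegative.\<close>
    have "chi R x powr M = chi R x powr (1 + (M - 1))" by simp
    also have "\<dots> = chi R x * chi R x powr (M - 1)"
      using chi_pos[of R x] by (subst powr_add) simp
    also have "\<dots> \<le> chi R x * chi Q x powr (M - 1)"
      using chi_pos[of R x] M that Q
      by (intro mult_left_mono powr_mono2 chi_mono) (auto intro: less_imp_le)
    finally have "cmod (f x) powr s * chi R x powr M
        \<le> cmod (f x) powr s * (chi R x * chi Q x powr (M - 1))"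
      by (rule mult_left_mono) simp
    then have "ennreal (cmod (f x) powr s * chi R x powr M)
        \<le> ennreal (chi R x * (cmod (f x) powr s * chi Q x powr (M - 1)))"
      by (intro ennreal_leI) (simp add: ac_simps)
    also have "\<dots> = ennreal (chi R x) * w x"
      unfolding w_def using chi_pos[of R x] by (intro ennreal_mult) auto
    finally show "ennreal (cmod (f x) powr s * chi R x powr M) \<le> ennreal (chi R x) * w x" .
  qed simp
  \<comment> \<open>A finite positive mass is required to define a positive threshold. With infinite
    mass no average over \<open>R\<close> exceeds the threshold, and with zero mass all averages
    over \<open>R\<close> vanish.\<close>
  consider "(\<integral>\<^sup>+x. w x \<partial>lebesgue) = \<infinity>" | "(\<integral>\<^sup>+x. w x \<partial>lebesgue) = 0"
    | I where "0 < I" "(\<integral>\<^sup>+x. w x \<partial>lebesgue) = ennreal I"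
    by (cases "\<integral>\<^sup>+x. w x \<partial>lebesgue") (auto simp: less_le)
  then show ?thesis
  proof cases
    case 1
    then have "avg s (M - 1) f Q = \<infinity>"
      unfolding avgQ using l by (simp add: ennreal_mult_eq_top_iff)
    then have "?J = {}" by (auto simp: ennreal_mult_eq_top_iff)
    then show ?thesis by (simp only: Union_empty emeasure_empty) simp
  next
    case 2
    have "avg s M f R = 0" if "R \<in> dyadic_intervals" "R \<subset> Q" for R
    proof -
      have "(\<integral>\<^sup>+x. ennreal (chi R x) * w x \<partial>lebesgue) \<le> (\<integral>\<^sup>+x. 1 * w x \<partial>lebesgue)"
        by (intro nn_integral_mono mult_right_mono) (auto simp: chi_le_1)
      then show ?thesis using avgR[OF that] 2 by simp
    qed
    then have "?J = {}" by auto
    then show ?thesis by (simp only: Union_empty emeasure_empty) simp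
  next
    case (3 I)
    \<comment> \<open>The threshold \<open>960 * avg s (M - 1) f Q\<close> as a real number.\<close>
    define t where "t = 960 * I / len Q"
    have t: "0 < t" using 3 l by (simp add: t_def)
    have "emeasure lebesgue (\<Union>?J) \<le> ennreal (80 * I / t)"
    proof (rule chi_weak_type[where w = w])
      fix R assume "R \<in> ?J"
      then have R: "R \<in> dyadic_intervals" "R \<subset> Q" "ennreal 960 * avg s (M - 1) f Q < avg s M f R"
        by auto
      have lR: "0 < len R" using len_dyadic_pos[OF R(1)] .
      have "ennreal t = ennreal 960 * avg s (M - 1) f Q"
        unfolding avgQ 3(2) t_def using 3(1) l by (simp flip: ennreal_mult' ennreal_numeral)
      then have "ennreal t < ennreal (1 / len R) * (\<integral>\<^sup>+x. ennreal (chi R x) * w x \<partial>lebesgue)"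
        using R(3) avgR[OF R(1,2)] by order
      then have "ennreal (len R) * ennreal t < ennreal (len R) *
         (ennreal (1 / len R) * (\<integral>\<^sup>+x. ennreal (chi R x) * w x \<partial>lebesgue))"
        using lR by (intro ennreal_mult_strict_left_mono) auto
      also have "\<dots> = (\<integral>\<^sup>+x. ennreal (chi R x) * w x \<partial>lebesgue)"
        using lR by (simp add: mult.assoc[symmetric] flip: ennreal_mult)
      finally show "ennreal (t * len R) < (\<integral>\<^sup>+x. ennreal (chi R x) * w x \<partial>lebesgue)"
        using lR t by (simp add: ennreal_mult mult.commute)
    qed (use 3 t in auto)
    also have "80 * I / t = len Q / 12" using 3 l by (simp add: t_def)
    finally show ?thesis .
  qed
qed

section \<open>Powers of averages, and suprema over \<open>localize_plus\<close>\<close>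

lemma avg_exponent_antimono: "avg s M f Q \<le> avg s (M - 1) f Q"
  unfolding avg_def
  using chi_pos[of Q] chi_le_1[of Q]
  by (intro mult_left_mono nn_integral_mono ennreal_leI powr_mono') (auto intro: less_imp_le)

lemma ennpow_mono: "a \<le> b \<Longrightarrow> 0 \<le> r \<Longrightarrow> ennpow a r \<le> ennpow b r"
  by (cases a; cases b) (auto simp: ennpow_def top_unique intro!: ennreal_leI powr_mono2)

text \<open>For \<open>c\<close> at least 1 and \<open>r\<close> at most 1, \<open>c powr r\<close>
  is at most \<open>c\<close>; so the constant 960 serves for all of \<open>s1\<close>,
  \<open>s2\<close>, \<open>s3\<close>.\<close>

lemma ennpow_scale_le:
  assumes "1 \<le> c" "0 < r" "r \<le> 1"
  shows "ennpow (ennreal c * a) r \<le> ennreal c * ennpow a r"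
proof (cases a)
  case (real x)
  have "(c * x) powr r = c powr r * x powr r"
    by (rule powr_mult)
  also have "\<dots> \<le> c * x powr r"
    using assms powr_mono[of r 1 c] by (intro mult_right_mono) auto
  finally show ?thesis
    using assms real by (simp add: ennpow_def flip: ennreal_mult)
next
  case top
  then show ?thesis using assms by (auto simp: ennpow_def ennreal_mult_eq_top_iff)
qed

text \<open>The frequency interval is given the reciprocal length \<open>2 powi (-k)\<close>.
  Existence ensures that the \<open>SOME\<close> in \<open>localize_plus\<close> really picks a
  tri-tile over the given interval.\<close>

lemma ex_tri_tile:
  assumes "Q \<in> dyadic_intervals"
  shows "\<exists>P. is_tri_tile P \<and> spatial P = Q"
proof -
  obtain k n where Q: "Q = {2 powi k * of_int n ..< 2 powi k * (of_int n + 1)}"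
    using dyadic_cases[OF assms] .
  define \<omega> :: "real set" where "\<omega> = {2 powi (-k) * of_int 0 ..< 2 powi (-k) * (of_int 0 + 1)}"
  have "\<omega> \<in> dyadic_intervals" unfolding \<omega>_def dyadic_intervals_def by blast
  then have "\<omega> \<in> translated_dyadic 0" by (simp add: translated_dyadic_def)
  moreover have "len Q * len \<omega> = 1"
    unfolding Q \<omega>_def len_dyadic by (simp add: power_int_minus)
  ultimately have "is_tile (Q, \<omega>)" using assms by (auto simp: is_tile_def)
  then have "is_tri_tile ((Q, \<omega>), (Q, \<omega>), (Q, \<omega>))" by (simp add: is_tri_tile_def)
  then show ?thesis by (intro exI conjI) (auto simp: spatial_def tile1_def)
qed

lemma spatial_dyadic: "is_tri_tile P \<Longrightarrow> spatial P \<in> dyadic_intervals"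
  by (auto simp: is_tri_tile_def is_tile_def spatial_def tile1_def split: prod.splits)

text \<open>The added tri-tile, like any other over \<open>Q\<close>, falls under the first case,
  where lowering the exponent from \<open>M\<close> to \<open>M - 1\<close> only enlarges the
  average.\<close>

lemma SUP_localize_plus_le:
  assumes "Q \<in> dyadic_intervals"
    and "\<And>P. P \<in> PP \<Longrightarrow> spatial P = Q \<or> avg s M f (spatial P) \<le> ennreal 960 * avg s (M - 1) f Q"
  shows "(SUP P\<in>localize_plus PP Q. avg s M f (spatial P)) \<le> ennreal 960 * avg s (M - 1) f Q"
proof (rule SUP_least)
  fix P assume "P \<in> localize_plus PP Q"
  moreover have "spatial (SOME P. is_tri_tile P \<and> spatial P = Q) = Q"
    using someI_ex[OF ex_tri_tile[OF assms(1)]] by simp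
  ultimately consider "spatial P = Q" | "avg s M f (spatial P) \<le> ennreal 960 * avg s (M - 1) f Q"
    using assms(2)[of P] unfolding localize_plus_def localize_def by blast
  then show "avg s M f (spatial P) \<le> ennreal 960 * avg s (M - 1) f Q"
  proof cases
    case 1
    have "avg s M f Q \<le> 1 * avg s (M - 1) f Q" by (simp add: avg_exponent_antimono)
    also have "\<dots> \<le> ennreal 960 * avg s (M - 1) f Q"
      by (intro mult_right_mono) auto
    finally show ?thesis using 1 by simp
  qed
qed

section \<open>Unordered sums and bounds on their finite partial sums\<close>

lemma summable_if_bounded_partial_sums:
  fixes f :: "'a \<Rightarrow> complex"
  assumes "\<And>F. finite F \<Longrightarrow> F \<subseteq> A \<Longrightarrow> cmod (sum f F) \<le> b"
  shows "f summable_on A"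
proof -
  \<comment> \<open>A bound on all finite subsums excludes cancellation: the terms can be split by
    coordinate and by sign, hence the factor \<open>2 * real DIM(complex)\<close>.\<close>
  have "(\<Sum>x\<in>F. cmod (f x)) \<le> 2 * real DIM(complex) * b" if "finite F" "F \<subseteq> A" for F
    using that by (intro sum_norm_allsubsets_bound assms) (auto intro: finite_subset)
  then have "(\<lambda>x. cmod (f x)) summable_on A"
    by (subst abs_summable_iff_bdd_above) (intro bdd_aboveI2, auto)
  then show ?thesis by (rule abs_summable_summable)
qed

lemma cmod_infsum_le:
  fixes f :: "'a \<Rightarrow> complex"
  assumes "\<And>F. finite F \<Longrightarrow> F \<subseteq> A \<Longrightarrow> cmod (sum f F) \<le> b"
  shows "cmod (infsum f A) \<le> b"
proof -
  have "((\<lambda>F. sum f F) \<longlongrightarrow> infsum f A) (finite_subsets_at_top A)"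
    using summable_if_bounded_partial_sums[OF assms] by (rule infsum_tendsto)
  then have "((\<lambda>F. cmod (sum f F)) \<longlongrightarrow> cmod (infsum f A)) (finite_subsets_at_top A)"
    by (rule tendsto_norm)
  then show ?thesis
    by (rule tendsto_upperbound) (use assms in \<open>auto intro: eventually_finite_subsets_at_top_weakI\<close>)
qed

lemma sum_le_infsum_ennreal:
  fixes f :: "'a \<Rightarrow> ennreal"
  assumes "finite F" "F \<subseteq> A"
  shows "sum f F \<le> infsum f A"
proof -
  have "infsum f F \<le> infsum f A"
    using assms by (intro infsum_mono_neutral nonneg_summable_on_complete) auto
  then show ?thesis using assms by simp
qed

lemma ennreal_cmod_sum_le: "ennreal (cmod (sum f F)) \<le> (\<Sum>x\<in>F. ennreal (cmod (f x)))"
  by (simp add: sum_ennreal norm_sum ennreal_leI)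

section \<open>Sparse domination of the trilinear form\<close>

theorem proposition10:
  fixes s1 s2 s3 M C :: real and A :: "nat \<Rightarrow> real \<Rightarrow> real" and K :: nat
  assumes "1 \<le> s1" and "1 \<le> s2" and "1 \<le> s3" and "1 \<le> M" and "0 < C"
  shows "\<exists>\<eta> C'. 0 < \<eta> \<and> \<eta> < 1 \<and> 0 < C' \<and>
    (\<forall>PP \<phi>1 \<phi>2 \<phi>3.
       (\<forall>P\<in>PP. is_tri_tile P \<and> wave_packet A K (tile1 P) (\<phi>1 P)
          \<and> wave_packet A K (tile2 P) (\<phi>2 P) \<and> wave_packet A K (tile3 P) (\<phi>3 P)) \<longrightarrow>
       (\<forall>PP'\<subseteq>PP. local_estimate C s1 s2 s3 M \<phi>1 \<phi>2 \<phi>3 PP') \<longrightarrow>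
       (\<forall>f g h. locally_integrable f \<longrightarrow> locally_integrable g \<longrightarrow> locally_integrable h \<longrightarrow>
          (\<exists>S. sparse_family \<eta> S \<and>
             (let B = (\<Sum>\<^sub>\<infinity>Q\<in>S. ennpow (avg s1 (M - 1) f Q) (1 / s1)
                          * ennpow (avg s2 (M - 1) g Q) (1 / s2)
                          * ennpow (avg s3 (M - 1) h Q) (1 / s3) * ennreal (len Q))
              in (B < \<infinity> \<longrightarrow> form_term \<phi>1 \<phi>2 \<phi>3 f g h summable_on PP) \<and>
                 ennreal (cmod (form \<phi>1 \<phi>2 \<phi>3 PP f g h)) \<le> ennreal C' * B))))"
proof (rule exI[of _ "1/4"], rule exI[of _ "C * 960 * 960 * 960"], intro conjI allI impI)
  fix PP \<phi>1 \<phi>2 \<phi>3 f g h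
  assume PP: "\<forall>P\<in>PP. is_tri_tile P \<and> wave_packet A K (tile1 P) (\<phi>1 P)
          \<and> wave_packet A K (tile2 P) (\<phi>2 P) \<and> wave_packet A K (tile3 P) (\<phi>3 P)"
    and local_est: "\<forall>PP'\<subseteq>PP. local_estimate C s1 s2 s3 M \<phi>1 \<phi>2 \<phi>3 PP'"
    and fgh: "locally_integrable f" "locally_integrable g" "locally_integrable h"
  let ?big = "\<lambda>s f Q R. ennreal 960 * avg s (M - 1) f Q < avg s M f R"
  \<comment> \<open>Tower intervals always count as stopped, as the nesting of the family
    demands.\<close>
  define stop where "stop = (\<lambda>Q R. R \<in> tower \<or> ?big s1 f Q R \<or> ?big s2 g Q R \<or> ?big s3 h Q R)"
  define S where "S = stopping_family stop"
  define b where "b = (\<lambda>Q. ennpow (avg s1 (M - 1) f Q) (1 / s1)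
                          * ennpow (avg s2 (M - 1) g Q) (1 / s2)
                          * ennpow (avg s3 (M - 1) h Q) (1 / s3) * ennreal (len Q))"
  let ?B = "\<Sum>\<^sub>\<infinity>Q\<in>S. b Q" and ?C = "C * 960 * 960 * 960"
  let ?T = "form_term \<phi>1 \<phi>2 \<phi>3 f g h"
  \<comment> \<open>The tower takes at most 1/2 of \<open>Q\<close> and each of the three averages
    at most 1/12, together 3/4; this leaves 1/4 for the disjoint parts.\<close>
  have "sparse_family (1/4) S"
    unfolding S_def
  proof (rule sparse_stopping_family)
    fix Q assume Q: "Q \<in> dyadic_intervals"
    let ?D = "\<lambda>s f. {R \<in> dyadic_intervals. R \<subset> Q \<and> ?big s f Q R}" and ?W = "{R \<in> tower. R \<subset> Q}"
    have meas: "\<Union>\<A> \<in> sets lebesgue" if "\<A> \<subseteq> dyadic_intervals" for \<A>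
      using that dyadic_sets countable_subset[OF that countable_dyadic]
      by (intro sets.countable_Union) auto
    have m: "\<Union>(?D s f) \<in> sets lebesgue" "\<Union>?W \<in> sets lebesgue" for s f
      by (intro meas; use tower_dyadic in auto)+
    have "\<Union>{R \<in> dyadic_intervals. R \<subset> Q \<and> stop Q R}
        \<subseteq> \<Union>?W \<union> (\<Union>(?D s1 f) \<union> (\<Union>(?D s2 g) \<union> \<Union>(?D s3 h)))"
      unfolding stop_def by blast
    then have "emeasure lebesgue (\<Union>{R \<in> dyadic_intervals. R \<subset> Q \<and> stop Q R})
        \<le> emeasure lebesgue (\<Union>?W \<union> (\<Union>(?D s1 f) \<union> (\<Union>(?D s2 g) \<union> \<Union>(?D s3 h))))"
      using m by (intro emeasure_mono sets.Un)
    also have "\<dots> \<le> emeasure lebesgue (\<Union>?W) + (emeasure lebesgue (\<Union>(?D s1 f)) +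
        (emeasure lebesgue (\<Union>(?D s2 g)) + emeasure lebesgue (\<Union>(?D s3 h))))"
      using m by (intro order.trans[OF emeasure_subadditive] add_mono sets.Un order.refl)
    also have "\<dots> \<le> ennreal (len Q / 2) + (ennreal (len Q / 12) + (ennreal (len Q / 12) + ennreal (len Q / 12)))"
      using fgh assms Q by (intro add_mono tower_below_half large_average_small)
    also have "\<dots> = ennreal ((1 - 1/4) * len Q)"
      by (simp flip: ennreal_plus)
    finally show "emeasure lebesgue (\<Union>{R \<in> dyadic_intervals. R \<subset> Q \<and> stop Q R})
        \<le> ennreal ((1 - 1/4) * len Q)" .
  qed (auto simp: stop_def)
  \<comment> \<open>Each tri-tile is assigned to a member that equals its spatial interval or does
    not stop at it; in either case the averages over that interval are controlled by those over the
    member.\<close>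
  moreover have "\<forall>P\<in>PP. \<exists>Q\<in>S. spatial P \<subseteq> Q \<and> (spatial P = Q \<or> \<not> stop Q (spatial P))"
    unfolding S_def using PP spatial_dyadic ex_stopping_interval by blast
  then obtain q where q: "\<And>P. P \<in> PP \<Longrightarrow> q P \<in> S" "\<And>P. P \<in> PP \<Longrightarrow> spatial P \<subseteq> q P"
    "\<And>P. P \<in> PP \<Longrightarrow> spatial P = q P \<or> \<not> stop (q P) (spatial P)"
    by metis
  have block: "ennreal (cmod (sum ?T F)) \<le> ennreal ?C * b Q"
    if F: "finite F" "F \<subseteq> PP" and Q: "Q \<in> S" and qF: "\<And>P. P \<in> F \<Longrightarrow> q P = Q" for F Q
  proof -
    have QD: "Q \<in> dyadic_intervals" using Q stopping_family_dyadic by (auto simp: S_def)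
    \<comment> \<open>All spatial intervals lie in \<open>Q\<close>, so the local estimate for the
      collection \<open>F\<close> at \<open>Q\<close> bounds the sum over \<open>F\<close>
      itself.\<close>
    have "localize F Q = F"
      unfolding localize_def using q(2) F(2) qF by blast
    then have form: "form \<phi>1 \<phi>2 \<phi>3 (localize F Q) f g h = sum ?T F"
      using F by (simp add: form_def)
    have nonstop: "spatial P = Q \<or> \<not> stop Q (spatial P)" if "P \<in> F" for P
      using q(3)[of P] qF[OF that] that F by auto
    have pow: "ennpow (SUP P\<in>localize_plus F Q. avg s M u (spatial P)) (1 / s)
        \<le> ennreal 960 * ennpow (avg s (M - 1) u Q) (1 / s)"
      if "1 \<le> s" "\<And>R. ?big s u Q R \<Longrightarrow> stop Q R" for s u
    proof -
      have "(SUP P\<in>localize_plus F Q. avg s M u (spatial P)) \<le> ennreal 960 * avg s (M - 1) u Q"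
        using QD nonstop that(2) by (intro SUP_localize_plus_le) (meson not_le)+
      then have "ennpow (SUP P\<in>localize_plus F Q. avg s M u (spatial P)) (1 / s)
          \<le> ennpow (ennreal 960 * avg s (M - 1) u Q) (1 / s)"
        using that(1) by (intro ennpow_mono) auto
      also have "\<dots> \<le> ennreal 960 * ennpow (avg s (M - 1) u Q) (1 / s)"
        using that(1) by (intro ennpow_scale_le) auto
      finally show ?thesis .
    qed
    have "ennreal (cmod (sum ?T F)) \<le> ennreal C
          * ennpow (SUP P\<in>localize_plus F Q. avg s1 M f (spatial P)) (1 / s1)
          * ennpow (SUP P\<in>localize_plus F Q. avg s2 M g (spatial P)) (1 / s2)
          * ennpow (SUP P\<in>localize_plus F Q. avg s3 M h (spatial P)) (1 / s3)
          * ennreal (len Q)"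
      using local_est F(2) QD fgh unfolding form[symmetric] local_estimate_def by blast
    \<comment> \<open>Each of the three suprema costs a factor 960.\<close>
    also have "\<dots> \<le> ennreal C
          * (ennreal 960 * ennpow (avg s1 (M - 1) f Q) (1 / s1))
          * (ennreal 960 * ennpow (avg s2 (M - 1) g Q) (1 / s2))
          * (ennreal 960 * ennpow (avg s3 (M - 1) h Q) (1 / s3))
          * ennreal (len Q)"
      using assms by (intro mult_mono pow order.refl) (auto simp: stop_def)
    also have "\<dots> = ennreal C * ennreal 960 * ennreal 960 * ennreal 960 * b Q"
      unfolding b_def by (simp only: ac_simps)
    also have "ennreal C * ennreal 960 * ennreal 960 * ennreal 960 = ennreal ?C"
      using assms(5) by (simp only: ennreal_mult'[symmetric] zero_le_numeral)
    finally show ?thesis .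
  qed
  have partial: "ennreal (cmod (sum ?T F)) \<le> ennreal ?C * ?B" if F: "finite F" "F \<subseteq> PP" for F
  proof -
    \<comment> \<open>Grouping by \<open>q\<close> yields finitely many distinct members of
      \<open>S\<close>, so each \<open>b Q\<close> is used at most once.\<close>
    have "sum ?T F = (\<Sum>Q\<in>q ` F. sum ?T {P \<in> F. q P = Q})"
      using F by (intro sum.image_gen)
    then have "ennreal (cmod (sum ?T F)) \<le> (\<Sum>Q\<in>q ` F. ennreal (cmod (sum ?T {P \<in> F. q P = Q})))"
      using ennreal_cmod_sum_le by simp
    also have "\<dots> \<le> (\<Sum>Q\<in>q ` F. ennreal ?C * b Q)"
      using F q(1) by (intro sum_mono block) auto
    also have "\<dots> = ennreal ?C * (\<Sum>Q\<in>q ` F. b Q)"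
      by (simp only: sum_distrib_left)
    also have "\<dots> \<le> ennreal ?C * ?B"
      using F q(1) by (intro mult_left_mono sum_le_infsum_ennreal) auto
    finally show ?thesis .
  qed
  have "(?B < \<infinity> \<longrightarrow> ?T summable_on PP) \<and>
      ennreal (cmod (form \<phi>1 \<phi>2 \<phi>3 PP f g h)) \<le> ennreal ?C * ?B"
  proof (cases "?B")
    case (real B)
    \<comment> \<open>One real bound for all finite partial sums yields both the convergence and the
      estimate of the limit.\<close>
    have bound: "cmod (sum ?T F) \<le> ?C * B" if "finite F" "F \<subseteq> PP" for F
      using partial[OF that] real assms(5) by (simp only: ennreal_mult[symmetric]) simp
    show ?thesis
      using summable_if_bounded_partial_sums[OF bound] cmod_infsum_le[OF bound] real assms(5)
      by (auto simp: form_def ennreal_mult[symmetric])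
  next
    case top
    \<comment> \<open>With \<open>?B\<close> infinite the premise of the convergence claim fails,
      and positivity of \<open>?C\<close> makes the right-hand side infinite.\<close>
    then show ?thesis using assms(5) by (auto simp: ennreal_mult_eq_top_iff)
  qed
  ultimately show "\<exists>S. sparse_family (1/4) S \<and>
             (let B = (\<Sum>\<^sub>\<infinity>Q\<in>S. ennpow (avg s1 (M - 1) f Q) (1 / s1)
                          * ennpow (avg s2 (M - 1) g Q) (1 / s2)
                          * ennpow (avg s3 (M - 1) h Q) (1 / s3) * ennreal (len Q))
              in (B < \<infinity> \<longrightarrow> form_term \<phi>1 \<phi>2 \<phi>3 f g h summable_on PP) \<and>
                 ennreal (cmod (form \<phi>1 \<phi>2 \<phi>3 PP f g h)) \<le> ennreal ?C * B)"
    unfolding b_def Let_def by blast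
qed (use assms in auto)

end
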